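(* Let $\{\varphi_i\}_{i=1}^\infty$ and $\{\psi_i\}_{i=1}^\infty$ be Riesz bases for a Hilbert space $\mathbb{H}$, and suppose that there is a uniform constant $A>0$ such that for every $\sigma\subset\mathbb{N}$ the family $\{\varphi_i\}_{i\in\sigma}\cup\{\psi_i\}_{i\in\sigma^c}$ is a frame for $\mathbb{H}$ with lower frame bound $A$. Then for every $\sigma\subset\mathbb{N}$ the family $\{\varphi_i\}_{i\in\sigma}\cup\{\psi_i\}_{i\in\sigma^c}$ is a Riesz basis for $\mathbb{H}$.
   Context: A family $\{f_i\}_{i\in I}$ in $\mathbb{H}$ is a frame for $\mathbb H$ with lower and upper frame bounds $A,B$ if $0<A\le B<\infty$ and $A\|x\|^2\le \sum_{i\in I}|\langle x,f_i\rangle|^2\le B\|x\|^2$ for all $x\in\mathbb{H}$. It is a Riesz sequence with lower and upper Riesz bounds $A,B$ if $0<A\le B<\infty$ and $A\sum_{i}|c_i|^2\le\|\sum_{i}c_if_i\|^2\le B\sum_{i}|c_i|^2$ for all $\{c_i\}\in\ell^2(I)$; it is a Riesz basis for $\mathbb{H}$ if in addition it is complete in $\mathbb{H}$ (its closed span is $\mathbb{H}$). Here $\sigma^c=\mathbb{N}\setminus\sigma$ and unions of families are understood as indexed families (with multiplicity). *)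

theory Defs
  imports "HOL-Analysis.Analysis"
begin

text \<open>
  Scalars: the class captures the real and the complex field simultaneously. In a model,
  x * conjugate x and (1 + x) * conjugate (1 + x) are real, hence so is
  x + conjugate x; so every x is a root of a real quadratic polynomial, and the model is
  isomorphic to the reals or to the complex numbers.
\<close>

class real_or_complex = real_normed_field +
  fixes conjugate :: "'a \<Rightarrow> 'a"
  assumes conjugate_add: "conjugate (x + y) = conjugate x + conjugate y"
    and conjugate_mult: "conjugate (x * y) = conjugate x * conjugate y"
    and conjugate_conjugate: "conjugate (conjugate x) = x"
    and mult_conjugate: "x * conjugate x = (norm x)\<^sup>2 *\<^sub>R 1"

instantiation real :: real_or_complex
begin
definition conjugate_real :: "real \<Rightarrow> real" where "conjugate_real x = x"
instance by standard (simp_all add: conjugate_real_def power2_eq_square)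
end

instantiation complex :: real_or_complex
begin
definition conjugate_complex :: "complex \<Rightarrow> complex" where "conjugate_complex = cnj"
instance
  by standard
    (simp_all add: conjugate_complex_def scaleR_conv_of_real flip: complex_norm_square)
end

text \<open>
  A Hilbert space over such a scalar field. The norm, the topology and completeness come from
  the class banach; the axioms tie them to the scalar multiplication and the inner product,
  which is linear in its first argument. Positive definiteness of the inner product is
  contained in ip_self.
\<close>

locale hilbert_space = vector_space smul
  for smul :: "'k::real_or_complex \<Rightarrow> 'a::banach \<Rightarrow> 'a" +
  fixes ip :: "'a \<Rightarrow> 'a \<Rightarrow> 'k"
  assumes smul_of_real: "smul (of_real r) x = r *\<^sub>R x"
    and ip_add_left: "ip (x + y) z = ip x z + ip y z"
    and ip_smul_left: "ip (smul c x) y = c * ip x y"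
    and ip_commute: "ip y x = conjugate (ip x y)"
    and ip_self: "ip x x = of_real ((norm x)\<^sup>2)"

lemma hilbert_space_real:
  "hilbert_space (scaleR :: real \<Rightarrow> 'a::{real_inner, banach} \<Rightarrow> 'a) inner"
  by standard
    (simp_all add: algebra_simps conjugate_real_def inner_commute power2_norm_eq_inner)

lemma hilbert_space_complex:
  "hilbert_space ((*) :: complex \<Rightarrow> complex \<Rightarrow> complex) (\<lambda>x y. x * cnj y)"
  by standard
    (simp_all add: algebra_simps conjugate_complex_def scaleR_conv_of_real
      flip: complex_norm_square)

definition is_frame ::
  "('a::real_normed_vector \<Rightarrow> 'a \<Rightarrow> 'k::real_normed_field) \<Rightarrow> 'i set \<Rightarrow> ('i \<Rightarrow> 'a) \<Rightarrow>
    real \<Rightarrow> real \<Rightarrow> bool" where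
  "is_frame ip I f A B \<longleftrightarrow> 0 < A \<and> A \<le> B \<and>
    (\<forall>x. (\<lambda>i. (norm (ip x (f i)))\<^sup>2) summable_on I \<and>
         A * (norm x)\<^sup>2 \<le> (\<Sum>\<^sub>\<infinity>i\<in>I. (norm (ip x (f i)))\<^sup>2) \<and>
         (\<Sum>\<^sub>\<infinity>i\<in>I. (norm (ip x (f i)))\<^sup>2) \<le> B * (norm x)\<^sup>2)"

text \<open>
  Convergence of the vector series is part of the condition, since infsum takes the value 0 on
  families that are not summable. Unordered convergence is no extra demand: the upper bound
  for finitely supported coefficients already forces it when the space is complete.
\<close>

definition riesz_sequence ::
  "('k::real_normed_field \<Rightarrow> 'a::real_normed_vector \<Rightarrow> 'a) \<Rightarrow> 'i set \<Rightarrow> ('i \<Rightarrow> 'a) \<Rightarrow>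
    real \<Rightarrow> real \<Rightarrow> bool" where
  "riesz_sequence smul I f A B \<longleftrightarrow> 0 < A \<and> A \<le> B \<and>
    (\<forall>c. (\<lambda>i. (norm (c i))\<^sup>2) summable_on I \<longrightarrow>
         (\<lambda>i. smul (c i) (f i)) summable_on I \<and>
         A * (\<Sum>\<^sub>\<infinity>i\<in>I. (norm (c i))\<^sup>2) \<le> (norm (\<Sum>\<^sub>\<infinity>i\<in>I. smul (c i) (f i)))\<^sup>2 \<and>
         (norm (\<Sum>\<^sub>\<infinity>i\<in>I. smul (c i) (f i)))\<^sup>2 \<le> B * (\<Sum>\<^sub>\<infinity>i\<in>I. (norm (c i))\<^sup>2))"

definition riesz_basis ::
  "('k::real_normed_field \<Rightarrow> 'a::real_normed_vector \<Rightarrow> 'a) \<Rightarrow> 'i set \<Rightarrow> ('i \<Rightarrow> 'a) \<Rightarrow> bool"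
  where
  "riesz_basis smul I f \<longleftrightarrow>
    (\<exists>A B. riesz_sequence smul I f A B) \<and> closure (module.span smul (f ` I)) = UNIV"

text \<open>
  The union of the families f on S and g on the complement of S. The two index sets partition
  the index type, so their union as indexed families (with multiplicity) is again a family
  over the whole index type.
\<close>

definition weaving :: "'i set \<Rightarrow> ('i \<Rightarrow> 'a) \<Rightarrow> ('i \<Rightarrow> 'a) \<Rightarrow> 'i \<Rightarrow> 'a" where
  "weaving S f g = (\<lambda>i. if i \<in> S then f i else g i)"

end

theory Submission
  imports Defs
begin

text \<open>
  A biorthogonal system turns a lower frame bound into a lower Riesz bound with the same
  constant. Suppose that \<open>ip (h j) (f i)\<close> is 1 for \<open>i = j\<close> and 0 otherwise, and let \<open>c\<close> be
  finitely supported. The vector \<open>y = \<Sum>j. c j h j\<close> has frame coefficients \<open>ip y (f i) = c i\<close>,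
  so the frame inequality gives \<open>A \<parallel>y\<parallel>\<^sup>2 \<le> \<parallel>c\<parallel>\<^sup>2\<close>, while
  \<open>\<parallel>c\<parallel>\<^sup>2 = ip y (\<Sum>i. c i f i) \<le> \<parallel>y\<parallel> \<parallel>\<Sum>i. c i f i\<parallel>\<close>. Together these yield
  \<open>A \<parallel>c\<parallel>\<^sup>2 \<le> \<parallel>\<Sum>i. c i f i\<parallel>\<^sup>2\<close> (\<open>biorthogonal_lower_bound\<close>).

  It remains to find biorthogonal systems. The Riesz basis \<open>\<psi>\<close> is itself the weaving for the
  empty set, hence a frame, and it has a biorthogonal system (\<open>riesz_basis_biorthogonal\<close>).
  Biorthogonality survives the replacement of one vector as long as the new family is still a
  frame (\<open>biorthogonal_exchange\<close>): this is the elementary form of the fact that a surjective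
  Fredholm operator of index zero is injective. So every weaving for a finite set has a
  biorthogonal system, and therefore the lower Riesz bound \<open>A\<close>.

  For arbitrary \<open>\<sigma>\<close> the uniformity of \<open>A\<close> enters. On coefficients supported in a finite
  set \<open>F\<close>, the weavings for \<open>\<sigma>\<close> and for \<open>\<sigma> \<inter> F\<close> give the same vector, so the bound for finite
  sets holds for \<open>\<sigma>\<close> on all finitely supported coefficients, and in the limit on all
  square-summable ones. Completeness follows from the frame property, because the frame operator
  is onto (\<open>frame_expansion\<close>).
\<close>

text \<open>
  Boundedness of the operator that maps square-summable coefficients to their series. The bound
  is required to be positive so that it may be divided by.
\<close>

definition bounded_synthesis ::
  "('k::real_normed_field \<Rightarrow> 'a::real_normed_vector \<Rightarrow> 'a) \<Rightarrow> ('i \<Rightarrow> 'a) \<Rightarrow> real \<Rightarrow> bool" where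
  "bounded_synthesis smul f D \<longleftrightarrow> 0 < D \<and>
    (\<forall>c. (\<lambda>i. (norm (c i))\<^sup>2) summable_on UNIV \<longrightarrow>
         (\<lambda>i. smul (c i) (f i)) summable_on UNIV \<and>
         (norm (\<Sum>\<^sub>\<infinity>i. smul (c i) (f i)))\<^sup>2 \<le> D * (\<Sum>\<^sub>\<infinity>i. (norm (c i))\<^sup>2))"

definition biorthogonal ::
  "('a \<Rightarrow> 'a \<Rightarrow> 'k::real_normed_field) \<Rightarrow> ('i \<Rightarrow> 'a) \<Rightarrow> ('i \<Rightarrow> 'a) \<Rightarrow> bool" where
  "biorthogonal ip h f \<longleftrightarrow> (\<forall>i j. ip (h j) (f i) = (if i = j then 1 else 0))"

lemma riesz_sequence_bounded_synthesis:
  assumes "riesz_sequence smul UNIV f A B"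
  shows "bounded_synthesis smul f B"
  using assms unfolding riesz_sequence_def bounded_synthesis_def by auto

section \<open>Scalars and inner products\<close>

lemma conjugate_of_real: "conjugate (of_real r :: 'k::real_or_complex) = of_real r"
proof (cases "r = 0")
  case True
  have "conjugate (0::'k) + conjugate 0 = conjugate 0"
    by (metis add_0 conjugate_add)
  then show ?thesis using True by simp
next
  case False
  have "(of_real r :: 'k) * conjugate (of_real r) = of_real r * of_real r"
    unfolding mult_conjugate by (simp add: scaleR_conv_of_real power2_eq_square)
  then show ?thesis using False by simp
qed

context hilbert_space
begin

lemma ip_scaleR_left: "ip (r *\<^sub>R x) y = of_real r * ip x y"
  by (metis ip_smul_left smul_of_real)

lemma ip_zero_left [simp]: "ip 0 y = 0"
  using ip_scaleR_left[of 0 0 y] by simp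

lemma ip_minus_left: "ip (- x) y = - ip x y"
  using ip_scaleR_left[of "-1" x y] by simp

lemma ip_diff_left: "ip (x - y) z = ip x z - ip y z"
  using ip_add_left[of x "- y" z] by (simp add: ip_minus_left)

lemma ip_sum_left: "ip (sum g F) z = (\<Sum>j\<in>F. ip (g j) z)"
  by (induction F rule: infinite_finite_induct) (simp_all add: ip_add_left)

lemma ip_add_right: "ip x (y + z) = ip x y + ip x z"
  by (metis conjugate_add ip_add_left ip_commute)

lemma ip_smul_right: "ip x (smul c y) = conjugate c * ip x y"
  by (metis conjugate_mult ip_smul_left ip_commute)

lemma ip_scaleR_right: "ip x (r *\<^sub>R y) = of_real r * ip x y"
  by (metis ip_smul_right smul_of_real conjugate_of_real)

lemma ip_zero_right [simp]: "ip x 0 = 0"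
  using ip_scaleR_right[of x 0 0] by simp

lemma ip_sum_right: "finite F \<Longrightarrow> ip z (sum g F) = (\<Sum>j\<in>F. ip z (g j))"
  by (induction F rule: finite_induct) (simp_all add: ip_add_right)

text \<open>
  The terms of the frame operator at \<open>x\<close>, paired with \<open>x\<close>, are the terms of the frame sum.
\<close>

lemma ip_smul_ip: "ip (smul (ip x y) y) x = of_real ((norm (ip x y))\<^sup>2)"
  using mult_conjugate[of "ip x y"]
  by (simp add: ip_smul_left ip_commute[of y x] scaleR_conv_of_real)

lemma Cauchy_Schwarz: "norm (ip x y) \<le> norm x * norm y"
proof (cases "y = 0")
  case True
  then show ?thesis by simp
next
  case False
  define n2 where "n2 = (norm y)\<^sup>2"
  have n2: "n2 > 0" using False by (simp add: n2_def)
  \<comment> \<open>The residual of the projection of \<open>x\<close> onto the line through \<open>y\<close>.\<close>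
  define w where "w = x - smul (ip x y / of_real n2) y"
  have "ip w y = 0"
    using n2 by (simp add: w_def ip_diff_left ip_smul_left ip_self flip: n2_def)
  then have "ip w w = ip w x"
    by (metis add.right_neutral diff_add_cancel ip_add_right ip_smul_right mult_zero_right w_def)
  also have "ip w x = of_real ((norm x)\<^sup>2) - ip (smul (ip x y) y) x / of_real n2"
    unfolding w_def ip_diff_left ip_self ip_smul_left by simp
  also have "\<dots> = of_real ((norm x)\<^sup>2 - (norm (ip x y))\<^sup>2 / n2)"
    by (simp add: ip_smul_ip)
  finally have "(of_real ((norm w)\<^sup>2)::'k) = of_real ((norm x)\<^sup>2 - (norm (ip x y))\<^sup>2 / n2)"
    by (simp only: ip_self)
  then have "(norm w)\<^sup>2 = (norm x)\<^sup>2 - (norm (ip x y))\<^sup>2 / n2"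
    by (simp only: of_real_eq_iff)
  then have "(norm (ip x y))\<^sup>2 / n2 \<le> (norm x)\<^sup>2" by (smt (verit) zero_le_power2)
  then have "(norm (ip x y))\<^sup>2 \<le> (norm x * norm y)\<^sup>2"
    using n2 by (simp add: field_simps n2_def)
  then show ?thesis by (rule power2_le_imp_le) simp
qed

lemma bounded_linear_ip: "bounded_linear (\<lambda>x. ip x y)"
  by (rule bounded_linear_intro[where K = "norm y"])
    (simp_all add: ip_add_left ip_scaleR_left scaleR_conv_of_real Cauchy_Schwarz)

lemma norm_diff_scaleR_sq:
  assumes "ip v x = of_real r"
  shows "(norm (x - t *\<^sub>R v))\<^sup>2 = (norm x)\<^sup>2 - 2 * t * r + t\<^sup>2 * (norm v)\<^sup>2"
proof -
  have xv: "ip x v = of_real r"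
    using assms by (metis conjugate_of_real ip_commute)
  define w where "w = (- t) *\<^sub>R v"
  have "ip (x + w) (x + w) = ip x x + ip x w + ip w x + ip w w"
    by (simp add: ip_add_left ip_add_right)
  also have "\<dots> = of_real ((norm x)\<^sup>2 - 2 * t * r + t\<^sup>2 * (norm v)\<^sup>2)"
    unfolding w_def ip_scaleR_left ip_scaleR_right xv assms
    by (simp add: ip_self power2_eq_square)
  finally have "ip (x + w) (x + w) = of_real ((norm x)\<^sup>2 - 2 * t * r + t\<^sup>2 * (norm v)\<^sup>2)" .
  then show ?thesis unfolding ip_self of_real_eq_iff by (simp add: w_def)
qed

section \<open>Frame expansions\<close>

text \<open>
  The frame operator \<open>S\<close> is coercive, \<open>ip (S y) y \<ge> A \<parallel>y\<parallel>\<^sup>2\<close>, and bounded,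
  \<open>\<parallel>S y\<parallel>\<^sup>2 \<le> D B \<parallel>y\<parallel>\<^sup>2\<close>. As in the proof of the Lax-Milgram theorem, for small \<open>t > 0\<close>
  the map \<open>y \<mapsto> y - t (S y - x)\<close> is then a contraction, and its fixed point solves \<open>S y = x\<close>.
\<close>

lemma frame_expansion:
  assumes fr: "is_frame ip UNIV f A B" and D: "bounded_synthesis smul f D"
  shows "\<exists>y. ((\<lambda>i. smul (ip y (f i)) (f i)) has_sum x) UNIV"
proof -
  define S where "S y = (\<Sum>\<^sub>\<infinity>i. smul (ip y (f i)) (f i))" for y
  have A: "0 < A" and AB: "A \<le> B" using fr by (auto simp: is_frame_def)
  have sq: "(\<lambda>i. (norm (ip y (f i)))\<^sup>2) summable_on UNIV"
    and low: "A * (norm y)\<^sup>2 \<le> (\<Sum>\<^sub>\<infinity>i. (norm (ip y (f i)))\<^sup>2)"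
    and upp: "(\<Sum>\<^sub>\<infinity>i. (norm (ip y (f i)))\<^sup>2) \<le> B * (norm y)\<^sup>2" for y
    using fr by (auto simp: is_frame_def)
  have D0: "0 < D"
    and S: "((\<lambda>i. smul (ip y (f i)) (f i)) has_sum S y) UNIV"
    and S_le: "(norm (S y))\<^sup>2 \<le> D * (\<Sum>\<^sub>\<infinity>i. (norm (ip y (f i)))\<^sup>2)" for y
    using D sq[of y] by (auto simp: bounded_synthesis_def S_def)
  have S_diff: "S (y - z) = S y - S z" for y z
  proof -
    have "((\<lambda>i. smul (ip (y - z) (f i)) (f i) + smul (ip z (f i)) (f i)) has_sum (S (y - z) + S z)) UNIV"
      by (intro has_sum_add S)
    also have "(\<lambda>i. smul (ip (y - z) (f i)) (f i) + smul (ip z (f i)) (f i))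
        = (\<lambda>i. smul (ip y (f i)) (f i))"
      by (simp add: ip_diff_left flip: scale_left_distrib)
    finally show ?thesis using S[of y] has_sum_unique by (metis add_diff_cancel_right')
  qed
  have S_ip: "ip (S y) y = of_real (\<Sum>\<^sub>\<infinity>i. (norm (ip y (f i)))\<^sup>2)" for y
  proof -
    have "((\<lambda>i. ip (smul (ip y (f i)) (f i)) y) has_sum ip (S y) y) UNIV"
      by (rule has_sum_bounded_linear[OF bounded_linear_ip S])
    moreover have "((\<lambda>i. ip (smul (ip y (f i)) (f i)) y)
        has_sum of_real (\<Sum>\<^sub>\<infinity>i. (norm (ip y (f i)))\<^sup>2)) UNIV"
      unfolding ip_smul_ip using sq by (intro has_sum_of_real has_sum_infsum)
    ultimately show ?thesis by (rule has_sum_unique)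
  qed
  \<comment> \<open>The contraction factor of the iteration is at most the square root of
    \<open>1 - 2 t A + t\<^sup>2 D B\<close>. The step \<open>t\<close> below minimizes this expression and \<open>1 - A\<^sup>2 / (D B)\<close> is
    its minimum, which can be negative only in the zero space, where the constants are
    unrelated.\<close>
  define t where "t = A / (D * B)"
  define q where "q = max 0 (1 - A\<^sup>2 / (D * B))"
  have DB: "0 < D * B" using A AB D0 by simp
  have t: "0 < t" using A DB by (simp add: t_def)
  have q: "0 \<le> q" "q < 1" using A DB by (auto simp: q_def)
  have contr: "norm (y - t *\<^sub>R S y) \<le> sqrt q * norm y" for y
  proof -
    define E where "E = (\<Sum>\<^sub>\<infinity>i. (norm (ip y (f i)))\<^sup>2)"
    have "(norm (S y))\<^sup>2 \<le> D * (B * (norm y)\<^sup>2)"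
      using S_le[of y] upp[of y] D0 by (meson mult_left_mono less_imp_le order_trans)
    then have "t\<^sup>2 * (norm (S y))\<^sup>2 \<le> t\<^sup>2 * (D * (B * (norm y)\<^sup>2))"
      by (rule mult_left_mono) simp
    moreover have "2 * t * (A * (norm y)\<^sup>2) \<le> 2 * t * E"
      using low[of y] t by (intro mult_left_mono) (auto simp: E_def)
    moreover have "(norm (y - t *\<^sub>R S y))\<^sup>2 = (norm y)\<^sup>2 - 2 * t * E + t\<^sup>2 * (norm (S y))\<^sup>2"
      using S_ip[of y] by (intro norm_diff_scaleR_sq) (simp add: E_def)
    ultimately have "(norm (y - t *\<^sub>R S y))\<^sup>2
        \<le> (norm y)\<^sup>2 - 2 * t * (A * (norm y)\<^sup>2) + t\<^sup>2 * (D * (B * (norm y)\<^sup>2))"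
      by linarith
    also have "\<dots> = (1 - A\<^sup>2 / (D * B)) * (norm y)\<^sup>2"
      using DB by (simp add: t_def field_simps power2_eq_square)
    also have "\<dots> \<le> q * (norm y)\<^sup>2"
      by (intro mult_right_mono) (auto simp: q_def)
    also have "\<dots> = (sqrt q * norm y)\<^sup>2" using q by (simp add: power_mult_distrib)
    finally show ?thesis by (rule power2_le_imp_le) (use q in simp)
  qed
  have "\<exists>!y. y - t *\<^sub>R (S y - x) = y"
  proof (rule banach_fix_type)
    show "0 \<le> sqrt q" "sqrt q < 1" using q by auto
    show "\<forall>y z. dist (y - t *\<^sub>R (S y - x)) (z - t *\<^sub>R (S z - x)) \<le> sqrt q * dist y z"
    proof (intro allI)
      fix y z
      have "y - t *\<^sub>R (S y - x) - (z - t *\<^sub>R (S z - x)) = (y - z) - t *\<^sub>R S (y - z)"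
        by (simp add: S_diff scaleR_diff_right)
      then show "dist (y - t *\<^sub>R (S y - x)) (z - t *\<^sub>R (S z - x)) \<le> sqrt q * dist y z"
        unfolding dist_norm using contr[of "y - z"] by (simp only:)
    qed
  qed
  then obtain y where "y - t *\<^sub>R (S y - x) = y" by blast
  then have "S y = x" using t by simp
  then show ?thesis using S[of y] by blast
qed

lemma frame_complete:
  assumes "is_frame ip UNIV f A B" and "bounded_synthesis smul f D"
  shows "closure (span (range f)) = UNIV"
proof (intro equalityI subsetI UNIV_I)
  fix x
  obtain y where "((\<lambda>i. smul (ip y (f i)) (f i)) has_sum x) UNIV"
    using frame_expansion[OF assms] by blast
  then have "((\<lambda>F. \<Sum>i\<in>F. smul (ip y (f i)) (f i)) \<longlongrightarrow> x) (finite_subsets_at_top UNIV)"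
    by (simp add: has_sum_def)
  moreover have "\<forall>\<^sub>F F in finite_subsets_at_top UNIV.
      (\<Sum>i\<in>F. smul (ip y (f i)) (f i)) \<in> closure (span (range f))"
    by (intro always_eventually allI subsetD[OF closure_subset] span_sum span_scale span_base) auto
  ultimately show "x \<in> closure (span (range f))"
    by (intro Lim_in_closed_set[OF closed_closure]) auto
qed

section \<open>Biorthogonal systems\<close>

text \<open>
  Expand \<open>f k\<close> in the frame as \<open>\<Sum>i. ip y (f i) f i\<close>. The Riesz property makes expansions
  unique, so these coefficients are those of the trivial expansion of \<open>f k\<close>, which says that
  \<open>y\<close> is the vector biorthogonal to \<open>f k\<close>.
\<close>

lemma riesz_basis_biorthogonal:
  fixes f :: "'i \<Rightarrow> 'a"
  assumes fr: "is_frame ip UNIV f A B" and rs: "riesz_sequence smul UNIV f A' B'"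
  shows "\<exists>h. biorthogonal ip h f"
proof -
  have "\<exists>y. \<forall>i. ip y (f i) = (if i = k then 1 else 0)" for k
  proof -
    obtain y where y: "((\<lambda>i. smul (ip y (f i)) (f i)) has_sum f k) UNIV"
      using frame_expansion[OF fr riesz_sequence_bounded_synthesis[OF rs]] by blast
    \<comment> \<open>\<open>c\<close> is the difference of the two expansions of \<open>f k\<close>.\<close>
    define d :: "'i \<Rightarrow> 'k" where "d i = (if i = k then - 1 else 0)" for i
    define c where "c i = ip y (f i) + d i" for i
    have "((\<lambda>i. smul (d i) (f i)) has_sum - f k) UNIV"
      by (rule has_sum_finite_neutralI[of "{k}"]) (auto simp: d_def)
    from has_sum_add[OF y this]
    have "((\<lambda>i. smul (c i) (f i)) has_sum 0) UNIV"
      by (simp add: c_def scale_left_distrib)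
    then have zero: "(\<Sum>\<^sub>\<infinity>i. smul (c i) (f i)) = 0" by (rule infsumI)
    \<comment> \<open>\<open>c\<close> is square-summable because it differs from the frame coefficients only at \<open>k\<close>.\<close>
    have "(\<lambda>i. (norm (ip y (f i)))\<^sup>2) summable_on UNIV"
      using fr by (auto simp: is_frame_def)
    moreover have "(\<lambda>i. if i = k then (norm (c k))\<^sup>2 - (norm (ip y (f k)))\<^sup>2 else 0) summable_on UNIV"
      by (rule has_sum_imp_summable, rule has_sum_finite_neutralI[of "{k}"]) auto
    ultimately have "(\<lambda>i. (norm (ip y (f i)))\<^sup>2
        + (if i = k then (norm (c k))\<^sup>2 - (norm (ip y (f k)))\<^sup>2 else 0)) summable_on UNIV"
      by (rule summable_on_add)
    also have "(\<lambda>i. (norm (ip y (f i)))\<^sup>2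
        + (if i = k then (norm (c k))\<^sup>2 - (norm (ip y (f k)))\<^sup>2 else 0)) = (\<lambda>i. (norm (c i))\<^sup>2)"
      by (auto simp: c_def d_def)
    finally have sq: "(\<lambda>i. (norm (c i))\<^sup>2) summable_on UNIV" .
    then have "A' * (\<Sum>\<^sub>\<infinity>i. (norm (c i))\<^sup>2) \<le> 0" and "0 < A'"
      using rs zero by (auto simp: riesz_sequence_def)
    then have "(\<Sum>\<^sub>\<infinity>i. (norm (c i))\<^sup>2) \<le> 0" by (simp add: mult_le_0_iff)
    then have "(norm (c i))\<^sup>2 = 0" for i
      by (rule nonneg_infsum_le_0D[OF _ sq]) auto
    then have "c i = 0" for i by simp
    then have "ip y (f i) = - d i" for i
      unfolding c_def using eq_neg_iff_add_eq_0 by blast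
    then have "ip y (f i) = (if i = k then 1 else 0)" for i
      by (simp add: d_def)
    then show ?thesis by blast
  qed
  then show ?thesis unfolding biorthogonal_def by metis
qed

text \<open>
  The vector \<open>h k\<close> is orthogonal to every \<open>f i\<close> with \<open>i \<noteq> k\<close>. If it were orthogonal to \<open>g\<close> as
  well, the lower frame bound of the new family would force \<open>h k = 0\<close>. So \<open>h k\<close> can be rescaled
  to pair to 1 with \<open>g\<close>, and subtracting multiples of it makes the other \<open>h j\<close> orthogonal
  to \<open>g\<close>.
\<close>

lemma biorthogonal_exchange:
  assumes bi: "biorthogonal ip h f" and fr: "is_frame ip UNIV (f(k := g)) A B"
  shows "\<exists>h'. biorthogonal ip h' (f(k := g))"
proof -
  have hf: "ip (h j) (f i) = (if i = j then 1 else 0)" for i j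
    using bi by (simp add: biorthogonal_def)
  have "ip (h k) g \<noteq> 0"
  proof
    assume 0: "ip (h k) g = 0"
    have "ip (h k) ((f(k := g)) i) = 0" for i using 0 by (simp add: hf)
    then have "(\<Sum>\<^sub>\<infinity>i. (norm (ip (h k) ((f(k := g)) i)))\<^sup>2) = 0" by simp
    then have "A * (norm (h k))\<^sup>2 \<le> 0" and "0 < A"
      using fr unfolding is_frame_def by metis+
    then have "h k = 0" by (simp add: mult_le_0_iff)
    then show False using hf[of k k] by simp
  qed
  then have "biorthogonal ip
      (\<lambda>j. if j = k then smul (1 / ip (h k) g) (h k)
            else h j - smul (ip (h j) g / ip (h k) g) (h k)) (f(k := g))"
    by (auto simp: biorthogonal_def ip_diff_left ip_smul_left hf)
  then show ?thesis by blast
qed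

lemma weaving_biorthogonal:
  assumes "finite \<sigma>" and "biorthogonal ip h g"
    and fr: "\<And>\<sigma>. \<exists>B. is_frame ip UNIV (weaving \<sigma> f g) A B"
  shows "\<exists>h. biorthogonal ip h (weaving \<sigma> f g)"
  using assms(1)
proof induction
  case empty
  then show ?case using assms(2) by (auto simp: weaving_def)
next
  case (insert k \<sigma>)
  have "weaving (insert k \<sigma>) f g = (weaving \<sigma> f g)(k := f k)"
    by (auto simp: weaving_def)
  then show ?case using insert.IH fr[of "insert k \<sigma>"] biorthogonal_exchange by metis
qed

text \<open>
  By duality: \<open>c\<close> is the frame coefficient sequence of \<open>y = \<Sum>j. c j h j\<close>, so \<open>\<parallel>y\<parallel>\<close> is controlled
  by \<open>\<parallel>c\<parallel>\<close>, and the synthesized vector, paired with \<open>y\<close>, gives \<open>\<parallel>c\<parallel>\<^sup>2\<close>.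
\<close>

lemma biorthogonal_lower_bound:
  assumes bi: "biorthogonal ip h f" and fr: "is_frame ip UNIV f A B" and F: "finite F"
  shows "A * (\<Sum>i\<in>F. (norm (c i))\<^sup>2) \<le> (norm (\<Sum>i\<in>F. smul (c i) (f i)))\<^sup>2"
proof -
  define y where "y = (\<Sum>j\<in>F. smul (c j) (h j))"
  define E where "E = (\<Sum>i\<in>F. (norm (c i))\<^sup>2)"
  define v where "v = (\<Sum>i\<in>F. smul (c i) (f i))"
  have E0: "0 \<le> E" by (simp add: E_def sum_nonneg)
  have y: "ip y (f i) = (if i \<in> F then c i else 0)" for i
  proof -
    have "ip y (f i) = (\<Sum>j\<in>F. if i = j then c j else 0)"
      unfolding y_def ip_sum_left ip_smul_left
      using bi by (intro sum.cong) (auto simp: biorthogonal_def)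
    then show ?thesis using F by simp
  qed
  have "((\<lambda>i. (norm (ip y (f i)))\<^sup>2) has_sum E) UNIV"
    by (rule has_sum_finite_neutralI[OF F]) (auto simp: y E_def)
  then have low: "A * (norm y)\<^sup>2 \<le> E" and A: "0 < A"
    using fr infsumI unfolding is_frame_def by metis+
  have "ip y v = (\<Sum>i\<in>F. of_real ((norm (c i))\<^sup>2))"
    unfolding v_def ip_sum_right[OF F] ip_smul_right
    by (intro sum.cong) (auto simp: y mult.commute mult_conjugate scaleR_conv_of_real)
  then have "ip y v = of_real E" by (simp add: E_def)
  then have "E \<le> norm y * norm v"
    using Cauchy_Schwarz[of y v] E0 by simp
  then have "E\<^sup>2 \<le> (norm y * norm v)\<^sup>2"
    using E0 by (rule power_mono)
  then have "A * E\<^sup>2 \<le> A * (norm y)\<^sup>2 * (norm v)\<^sup>2"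
    using A by (simp add: power_mult_distrib mult.assoc)
  also have "\<dots> \<le> E * (norm v)\<^sup>2" using low by (rule mult_right_mono) simp
  finally have "E * (A * E) \<le> E * (norm v)\<^sup>2"
    by (simp add: power2_eq_square algebra_simps)
  then have "A * E \<le> (norm v)\<^sup>2"
    using E0 by (cases "E = 0") auto
  then show ?thesis by (simp add: E_def v_def)
qed

section \<open>Weavings\<close>

text \<open>
  The series of a weaving is the sum of the series of \<open>f\<close> and \<open>g\<close> with the coefficients cut off
  to \<open>\<sigma>\<close> and to its complement; the factor 2 comes from \<open>(a + b)\<^sup>2 \<le> 2 a\<^sup>2 + 2 b\<^sup>2\<close>.
\<close>

lemma weaving_bounded_synthesis:
  fixes f g :: "'i \<Rightarrow> 'a"
  assumes f: "bounded_synthesis smul f D" and g: "bounded_synthesis smul g D'"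
  shows "bounded_synthesis smul (weaving \<sigma> f g) (2 * (D + D'))"
  unfolding bounded_synthesis_def
proof (intro conjI allI impI)
  have D: "0 < D" "0 < D'" using f g by (auto simp: bounded_synthesis_def)
  then show "0 < 2 * (D + D')" by simp
  fix c :: "'i \<Rightarrow> 'k"
  assume c: "(\<lambda>i. (norm (c i))\<^sup>2) summable_on UNIV"
  define N where "N = (\<Sum>\<^sub>\<infinity>i. (norm (c i))\<^sup>2)"
  have part: "(\<lambda>i. smul (if P i then c i else 0) (u i)) summable_on UNIV \<and>
      (norm (\<Sum>\<^sub>\<infinity>i. smul (if P i then c i else 0) (u i)))\<^sup>2 \<le> d * N"
    if u: "bounded_synthesis smul u d" for P u d
  proof -
    have s: "(\<lambda>i. (norm (if P i then c i else 0))\<^sup>2) summable_on UNIV"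
      by (rule summable_on_comparison_test[OF c]) auto
    then have "(\<Sum>\<^sub>\<infinity>i. (norm (if P i then c i else 0))\<^sup>2) \<le> N"
      unfolding N_def using c by (intro infsum_mono) auto
    then have "d * (\<Sum>\<^sub>\<infinity>i. (norm (if P i then c i else 0))\<^sup>2) \<le> d * N"
      using u by (intro mult_left_mono) (auto simp: bounded_synthesis_def)
    then show ?thesis
      using u s unfolding bounded_synthesis_def by (meson order_trans)
  qed
  define a where "a i = smul (if i \<in> \<sigma> then c i else 0) (f i)" for i
  define b where "b i = smul (if i \<notin> \<sigma> then c i else 0) (g i)" for i
  have eq: "(\<lambda>i. smul (c i) (weaving \<sigma> f g i)) = (\<lambda>i. a i + b i)"
    by (auto simp: a_def b_def weaving_def)
  have a: "a summable_on UNIV" "(norm (infsum a UNIV))\<^sup>2 \<le> D * N"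
    using part[OF f, of "\<lambda>i. i \<in> \<sigma>"] unfolding a_def by auto
  have b: "b summable_on UNIV" "(norm (infsum b UNIV))\<^sup>2 \<le> D' * N"
    using part[OF g, of "\<lambda>i. i \<notin> \<sigma>"] unfolding b_def by auto
  show "(\<lambda>i. smul (c i) (weaving \<sigma> f g i)) summable_on UNIV"
    unfolding eq using a b by (intro summable_on_add)
  have "(norm (infsum a UNIV + infsum b UNIV))\<^sup>2
      \<le> (norm (infsum a UNIV) + norm (infsum b UNIV))\<^sup>2"
    by (intro power_mono norm_triangle_ineq) simp
  also have "\<dots> \<le> 2 * (norm (infsum a UNIV))\<^sup>2 + 2 * (norm (infsum b UNIV))\<^sup>2"
    by (smt (verit) sum_squares_bound power2_sum)
  also have "\<dots> \<le> 2 * (D + D') * N" using a(2) b(2) by (simp add: algebra_simps)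
  finally show "(norm (\<Sum>\<^sub>\<infinity>i. smul (c i) (weaving \<sigma> f g i)))\<^sup>2
      \<le> 2 * (D + D') * (\<Sum>\<^sub>\<infinity>i. (norm (c i))\<^sup>2)"
    unfolding eq N_def using a(1) b(1) by (simp add: infsum_add)
qed

text \<open>
  A finite sum over \<open>F\<close> sees only \<open>\<sigma> \<inter> F\<close>, so \<open>\<sigma>\<close> may be taken finite. This step
  needs the same lower frame bound \<open>A\<close> for all weavings.
\<close>

lemma weaving_finite_lower_bound:
  assumes bi: "biorthogonal ip h g"
    and fr: "\<And>\<sigma>. \<exists>B. is_frame ip UNIV (weaving \<sigma> f g) A B"
    and F: "finite F"
  shows "A * (\<Sum>i\<in>F. (norm (c i))\<^sup>2) \<le> (norm (\<Sum>i\<in>F. smul (c i) (weaving \<sigma> f g i)))\<^sup>2"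
proof -
  obtain h' where "biorthogonal ip h' (weaving (\<sigma> \<inter> F) f g)"
    using weaving_biorthogonal[OF _ bi fr, of "\<sigma> \<inter> F"] F by blast
  moreover obtain B where "is_frame ip UNIV (weaving (\<sigma> \<inter> F) f g) A B" using fr by blast
  ultimately have "A * (\<Sum>i\<in>F. (norm (c i))\<^sup>2)
      \<le> (norm (\<Sum>i\<in>F. smul (c i) (weaving (\<sigma> \<inter> F) f g i)))\<^sup>2"
    using F by (rule biorthogonal_lower_bound)
  also have "(\<Sum>i\<in>F. smul (c i) (weaving (\<sigma> \<inter> F) f g i))
      = (\<Sum>i\<in>F. smul (c i) (weaving \<sigma> f g i))"
    by (intro sum.cong) (auto simp: weaving_def)
  finally show ?thesis .
qed

lemma riesz_sequence_from_finite_bounds: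
  fixes f :: "'i \<Rightarrow> 'a"
  assumes "0 < A" and D: "bounded_synthesis smul f D"
    and fin: "\<And>c F. finite F \<Longrightarrow>
      A * (\<Sum>i\<in>F. (norm (c i))\<^sup>2) \<le> (norm (\<Sum>i\<in>F. smul (c i) (f i)))\<^sup>2"
  shows "riesz_sequence smul UNIV f A (max A D)"
  unfolding riesz_sequence_def
proof (intro conjI allI impI)
  fix c :: "'i \<Rightarrow> 'k"
  assume c: "(\<lambda>i. (norm (c i))\<^sup>2) summable_on UNIV"
  show s: "(\<lambda>i. smul (c i) (f i)) summable_on UNIV"
    using D c by (simp add: bounded_synthesis_def)
  have "((\<lambda>F. A * (\<Sum>i\<in>F. (norm (c i))\<^sup>2)) \<longlongrightarrow> A * (\<Sum>\<^sub>\<infinity>i. (norm (c i))\<^sup>2))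
      (finite_subsets_at_top UNIV)"
    using has_sum_infsum[OF c] unfolding has_sum_def by (intro tendsto_intros)
  moreover have "((\<lambda>F. (norm (\<Sum>i\<in>F. smul (c i) (f i)))\<^sup>2)
      \<longlongrightarrow> (norm (\<Sum>\<^sub>\<infinity>i. smul (c i) (f i)))\<^sup>2) (finite_subsets_at_top UNIV)"
    using has_sum_infsum[OF s] unfolding has_sum_def by (intro tendsto_intros)
  moreover have "\<forall>\<^sub>F F in finite_subsets_at_top UNIV.
      A * (\<Sum>i\<in>F. (norm (c i))\<^sup>2) \<le> (norm (\<Sum>i\<in>F. smul (c i) (f i)))\<^sup>2"
    by (rule eventually_finite_subsets_at_top_weakI) (rule fin)
  ultimately show "A * (\<Sum>\<^sub>\<infinity>i. (norm (c i))\<^sup>2) \<le> (norm (\<Sum>\<^sub>\<infinity>i. smul (c i) (f i)))\<^sup>2"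
    by (intro tendsto_le) auto
  have "(norm (\<Sum>\<^sub>\<infinity>i. smul (c i) (f i)))\<^sup>2 \<le> D * (\<Sum>\<^sub>\<infinity>i. (norm (c i))\<^sup>2)"
    using D c by (simp add: bounded_synthesis_def)
  also have "\<dots> \<le> max A D * (\<Sum>\<^sub>\<infinity>i. (norm (c i))\<^sup>2)"
    by (intro mult_right_mono infsum_nonneg) auto
  finally show "(norm (\<Sum>\<^sub>\<infinity>i. smul (c i) (f i)))\<^sup>2 \<le> max A D * (\<Sum>\<^sub>\<infinity>i. (norm (c i))\<^sup>2)" .
qed (use assms(1) in auto)

end

theorem theorem5p3:
  fixes smul :: "'k::real_or_complex \<Rightarrow> 'a::banach \<Rightarrow> 'a"
    and ip :: "'a \<Rightarrow> 'a \<Rightarrow> 'k"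
    and \<phi> \<psi> :: "nat \<Rightarrow> 'a"
  assumes "hilbert_space smul ip"
    and "riesz_basis smul UNIV \<phi>"
    and "riesz_basis smul UNIV \<psi>"
    and "\<exists>A>0. \<forall>\<sigma>. \<exists>B. is_frame ip UNIV (weaving \<sigma> \<phi> \<psi>) A B"
  shows "\<forall>\<sigma>. riesz_basis smul UNIV (weaving \<sigma> \<phi> \<psi>)"
proof
  fix \<sigma> :: "nat set"
  interpret hilbert_space smul ip by fact
  obtain A where A: "0 < A" and fr: "\<And>\<sigma>. \<exists>B. is_frame ip UNIV (weaving \<sigma> \<phi> \<psi>) A B"
    using assms(4) by blast
  obtain A1 B1 A2 B2 where \<phi>: "riesz_sequence smul UNIV \<phi> A1 B1"
    and \<psi>: "riesz_sequence smul UNIV \<psi> A2 B2"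
    using assms(2,3) unfolding riesz_basis_def by blast
  have "weaving {} \<phi> \<psi> = \<psi>" by (simp add: weaving_def)
  then obtain h where h: "biorthogonal ip h \<psi>"
    using riesz_basis_biorthogonal[OF _ \<psi>] fr[of "{}"] by metis
  obtain D where D: "bounded_synthesis smul (weaving \<sigma> \<phi> \<psi>) D"
    using weaving_bounded_synthesis[OF \<phi>[THEN riesz_sequence_bounded_synthesis]
        \<psi>[THEN riesz_sequence_bounded_synthesis]] by blast
  have "riesz_sequence smul UNIV (weaving \<sigma> \<phi> \<psi>) A (max A D)"
    using A D weaving_finite_lower_bound[OF h fr]
    by (rule riesz_sequence_from_finite_bounds)
  moreover have "closure (span (range (weaving \<sigma> \<phi> \<psi>))) = UNIV"
    using fr[of \<sigma>] frame_complete[OF _ D] by blast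
  ultimately show "riesz_basis smul UNIV (weaving \<sigma> \<phi> \<psi>)"
    unfolding riesz_basis_def by blast
qed

end
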